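(* Let $G(z,t)=\sum_{n\ge1,\,i\ge1} a_{n,i}\, z^n t^i$, where $a_{n,i}$ is the number of marked ordered trees with $n$ nodes and exactly $i$ deepest nodes. Let $v=v(z)$ be the power series \[ v=\frac{1-3z-\sqrt{1-6z+5z^2}}{2z}=z+3z^2+\cdots, \] so that $z=\dfrac{v}{1+3v+v^2}$, and put \[ q=\frac{v(v+2)}{2v+1},\qquad \delta=\frac{v(2v+1)}{v+2}. \] Then \[ G(z,t)=zt+\frac{z(v^2-1)}{v}\sum_{1\le i\le k}\binom{k}{i}\left(\frac{v-1}{v}\cdot\frac{t(1+v)z}{1-t(1+v)z}\right)^{i}\frac{\delta^k q^k}{1-q^k}, \] where the sum is over all integers $k\ge1$ and $1\le i\le k$.
   Context: An ordered tree is a rooted plane tree (children of each node are linearly ordered). A marked ordered tree is an ordered tree in which each edge that is the rightmost edge from a node to its children and which does not lead to a leaf (endnode) may additionally be either marked or unmarked; two marked ordered trees are different if the underlying ordered trees differ or the sets of marked edges differ. The size of a tree is its number of nodes. The depth (level) of a node is the number of nodes on the path from the root to it (the root has level 1); the height of a tree is the maximal level of its nodes, and the deepest nodes are the nodes whose level equals the height. In particular the one-node tree has one deepest node. The identity is understood as an identity of formal power series in $z$ and $t$. *)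

theory Defs
  imports "HOL-Analysis.Analysis" "HOL-Computational_Algebra.Computational_Algebra"
begin

subsection \<open>Ordered trees\<close>

datatype otree = Node (children: "otree list")

text \<open>
  A node is addressed by the path of child indices leading to it from the root, so
  \<open>[]\<close> is the root and \<open>p @ [i]\<close> is the \<open>i\<close>-th child (counted from the left, from 0) of \<open>p\<close>.
\<close>

primrec is_node :: "nat list \<Rightarrow> otree \<Rightarrow> bool" where
  "is_node [] T \<longleftrightarrow> True"
| "is_node (i # p) T \<longleftrightarrow> i < length (children T) \<and> is_node p (children T ! i)"

definition nodes :: "otree \<Rightarrow> nat list set" where
  "nodes T = {p. is_node p T}"

definition level :: "nat list \<Rightarrow> nat" where
  "level p = length p + 1"

definition height :: "otree \<Rightarrow> nat" where
  "height T = Max (level ` nodes T)"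

definition deepest_nodes :: "otree \<Rightarrow> nat list set" where
  "deepest_nodes T = {p \<in> nodes T. level p = height T}"

definition is_leaf :: "otree \<Rightarrow> nat list \<Rightarrow> bool" where
  "is_leaf T p \<longleftrightarrow> p \<in> nodes T \<and> (\<forall>i. p @ [i] \<notin> nodes T)"

text \<open>An edge is identified with its lower endpoint \<open>p @ [i]\<close>.\<close>

definition markable_edges :: "otree \<Rightarrow> nat list set" where
  "markable_edges T =
     {p @ [i] | p i. p @ [i] \<in> nodes T \<and> (\<forall>j>i. p @ [j] \<notin> nodes T) \<and> \<not> is_leaf T (p @ [i])}"

definition marked_otrees :: "(otree \<times> nat list set) set" where
  "marked_otrees = {(T, M). M \<subseteq> markable_edges T}"

definition num_marked_otrees :: "nat \<Rightarrow> nat \<Rightarrow> nat" where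
  "num_marked_otrees n i =
     card {(T, M) \<in> marked_otrees. card (nodes T) = n \<and> card (deepest_nodes T) = i}"

lemma nodes_Node:
  "nodes (Node Ts) = insert [] (\<Union>i<length Ts. (#) i ` nodes (Ts ! i))"
proof (rule set_eqI)
  fix p
  show "p \<in> nodes (Node Ts) \<longleftrightarrow> p \<in> insert [] (\<Union>i<length Ts. (#) i ` nodes (Ts ! i))"
    by (cases p) (auto simp: nodes_def)
qed

lemma finite_nodes: "finite (nodes T)"
  by (induction T) (auto simp: nodes_Node)

lemma card_nodes_Node:
  "card (nodes (Node Ts)) = Suc (\<Sum>i<length Ts. card (nodes (Ts ! i)))"
proof -
  have "card (\<Union>i<length Ts. (#) i ` nodes (Ts ! i)) = (\<Sum>i<length Ts. card ((#) i ` nodes (Ts ! i)))"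
    by (intro card_UN_disjoint) (auto simp: finite_nodes)
  moreover have "card ((#) i ` nodes (Ts ! i)) = card (nodes (Ts ! i))" for i
    by (intro card_image) (auto simp: inj_on_def)
  ultimately show ?thesis
    unfolding nodes_Node by (subst card_insert_disjoint) (auto simp: finite_nodes)
qed

lemma card_nodes_pos: "0 < card (nodes T)"
  by (cases T) (simp add: card_nodes_Node)

lemma card_nodes_nonzero: "card (nodes T) \<noteq> 0"
  using card_nodes_pos[of T] by simp

lemma finite_otrees_le: "finite {T. card (nodes T) \<le> n}"
proof (induction n)
  case 0
  show ?case by (simp add: card_nodes_nonzero)
next
  case (Suc n)
  have "{T. card (nodes T) \<le> Suc n} \<subseteq>
        Node ` {Ts. set Ts \<subseteq> {T. card (nodes T) \<le> n} \<and> length Ts \<le> n}"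
  proof
    fix T assume "T \<in> {T. card (nodes T) \<le> Suc n}"
    moreover obtain Ts where T: "T = Node Ts" by (cases T)
    ultimately have le: "(\<Sum>i<length Ts. card (nodes (Ts ! i))) \<le> n"
      by (simp add: card_nodes_Node)
    have "card (nodes (Ts ! i)) \<le> n" if "i < length Ts" for i
      using le member_le_sum[of i "{..<length Ts}" "\<lambda>i. card (nodes (Ts ! i))"] that by simp
    then have "set Ts \<subseteq> {T. card (nodes T) \<le> n}"
      by (auto simp: in_set_conv_nth)
    moreover have "length Ts \<le> n"
      using le sum_mono[of "{..<length Ts}" "\<lambda>_. 1" "\<lambda>i. card (nodes (Ts ! i))"] card_nodes_pos
      by (simp add: Suc_le_eq)
    ultimately show "T \<in> Node ` {Ts. set Ts \<subseteq> {T. card (nodes T) \<le> n} \<and> length Ts \<le> n}"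
      using T by blast
  qed
  moreover have "finite (Node ` {Ts. set Ts \<subseteq> {T. card (nodes T) \<le> n} \<and> length Ts \<le> n})"
    using Suc by (intro finite_imageI finite_lists_length_le)
  ultimately show ?case by (rule finite_subset)
qed

text \<open>The set counted by \<^const>\<open>num_marked_otrees\<close> is finite, so its cardinality is meaningful.\<close>

lemma finite_marked_otrees: "finite {(T, M) \<in> marked_otrees. card (nodes T) = n \<and> card (deepest_nodes T) = i}"
proof (rule finite_subset)
  show "{(T, M) \<in> marked_otrees. card (nodes T) = n \<and> card (deepest_nodes T) = i}
        \<subseteq> (SIGMA T:{T. card (nodes T) \<le> n}. Pow (nodes T))"
    by (auto simp: marked_otrees_def markable_edges_def)
  show "finite (SIGMA T:{T. card (nodes T) \<le> n}. Pow (nodes T))"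
    by (intro finite_SigmaI finite_otrees_le) (simp add: finite_nodes)
qed


subsection \<open>Bivariate series\<close>

text \<open>
  The ring \<open>\<real>[[z,t]]\<close> is embedded into the field \<open>\<real>((t))((z))\<close> of iterated Laurent series,
  rendered as \<^typ>\<open>real fls fls\<close> with \<open>z\<close> the outer and \<open>t\<close> the inner variable. Quotients such
  as \<open>(v - 1) / v\<close>, which are not power series, are then genuine quotients in a field.
  The topology on \<^typ>\<open>real fls fls\<close> is the \<open>z\<close>-adic one.
\<close>

definition ser_z :: "real fls fls" where
  "ser_z = fls_X"

definition ser_t :: "real fls fls" where
  "ser_t = fls_const fls_X"

text \<open>A series in \<open>z\<close> with real coefficients, regarded as an element of \<open>\<real>((t))((z))\<close>.\<close>

definition embed_z :: "real fps \<Rightarrow> real fls fls" where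
  "embed_z f = fps_to_fls (Abs_fps (\<lambda>n. fls_const (fps_nth f n)))"

text \<open>
  The coefficient of \<open>z\<^sup>n t\<^sup>i\<close> is \<open>num_marked_otrees n i\<close>; this vanishes if \<open>n = 0\<close> or \<open>i = 0\<close>.
\<close>

definition ser_G :: "real fls fls" where
  "ser_G = fps_to_fls (Abs_fps (\<lambda>n. fps_to_fls (Abs_fps (\<lambda>i. of_nat (num_marked_otrees n i)))))"

text \<open>
  The numerator has constant coefficient 0, so the division by \<open>2 * fps_X\<close> is exact.
\<close>

definition v_fps :: "real fps" where
  "v_fps = (1 - 3 * fps_X - fps_radical root 2 (1 - 6 * fps_X + 5 * fps_X ^ 2)) / (2 * fps_X)"

lemma num_marked_otrees_0:
  "num_marked_otrees 0 i = 0" "num_marked_otrees n 0 = 0"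
proof -
  show "num_marked_otrees 0 i = 0"
    by (simp add: num_marked_otrees_def card_nodes_nonzero)
  have "deepest_nodes T \<noteq> {}" for T
  proof -
    have "[] \<in> nodes T" by (simp add: nodes_def)
    then have "height T \<in> level ` nodes T"
      unfolding height_def by (intro Max_in) (auto simp: finite_nodes)
    then show ?thesis by (auto simp: deepest_nodes_def)
  qed
  moreover have "finite (deepest_nodes T)" for T
    by (simp add: deepest_nodes_def finite_nodes)
  ultimately show "num_marked_otrees n 0 = 0"
    by (simp add: num_marked_otrees_def)
qed

lemma v_fps_eq: "fps_X * (1 + 3 * v_fps + v_fps ^ 2) = v_fps"
  and v_fps_nth_0: "fps_nth v_fps 0 = 0"
  and v_fps_nth_1: "fps_nth v_fps 1 = 1"
proof -
  define a :: "real fps" where "a = 1 - 6 * fps_X + 5 * fps_X ^ 2"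
  define s where "s = fps_radical root 2 a"
  have a0: "fps_nth a 0 = 1" by (simp add: a_def)
  have s2: "s ^ 2 = a"
    using power_radical[of a root 1] a0 by (simp add: s_def numeral_2_eq_2)
  have s0: "fps_nth s 0 = 1" using a0 by (simp add: s_def)
  define u where "u = 1 - 3 * fps_X - s"
  have u0: "fps_nth u 0 = 0" by (simp add: u_def s0)
  have "(2 * fps_X :: real fps) dvd u"
  proof -
    have "u = 2 * fps_X * (fps_const (1/2) * fps_shift 1 u)"
    proof (rule fps_ext)
      fix n
      show "fps_nth u n = fps_nth (2 * fps_X * (fps_const (1/2) * fps_shift 1 u)) n"
        by (cases n) (simp_all add: u0 mult.assoc numeral_fps_const)
    qed
    then show ?thesis by (rule dvdI)
  qed
  then have vu: "2 * fps_X * v_fps = u"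
    by (simp add: v_fps_def u_def s_def a_def)
  have "(1 - 3 * fps_X - 2 * fps_X * v_fps) ^ 2 = a"
    using s2 by (simp add: vu u_def)
  then have "4 * fps_X * (fps_X * (1 + 3 * v_fps + v_fps ^ 2)) = 4 * fps_X * v_fps"
    unfolding a_def by algebra
  then show eq: "fps_X * (1 + 3 * v_fps + v_fps ^ 2) = v_fps"
    by simp
  have "fps_nth (fps_X * (1 + 3 * v_fps + v_fps ^ 2)) 0 = 0" by simp
  then show v0: "fps_nth v_fps 0 = 0" by (simp only: eq)
  have "fps_nth (fps_X * (1 + 3 * v_fps + v_fps ^ 2)) 1 = 1"
    by (simp add: v0 numeral_fps_const power2_eq_square)
  then show "fps_nth v_fps 1 = 1" by (simp only: eq)
qed

end

theory Submission
  imports Defs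
begin

text \<open>
  Let \<open>g\<^sub>d(u)\<close> count the marked trees of height at most \<open>d + 1\<close>, with \<open>u\<close> marking the nodes
  on level \<open>d + 1\<close>. Splitting off the leftmost subtree of the root gives
  \<open>g\<^sub>d\<^sub>+\<^sub>1 = z (1 + g\<^sub>d - z) / (1 - g\<^sub>d)\<close> for \<open>d \<ge> 1\<close>. This Moebius map has the fixed points
  \<open>M = z (1 + v)\<close> and \<open>M' = M / v\<close> and the multiplier \<open>q\<close>, so that
  \<open>g\<^sub>d\<^sub>+\<^sub>1 = M' + (M - M') / (1 - q\<^sup>d v\<^sup>2 (1 + U))\<close>, where \<open>U\<close> is the expression raised to the power
  \<open>i\<close> in the theorem. The trees of height exactly \<open>d + 1\<close> are counted by \<open>g\<^sub>d(t) - g\<^sub>d(0)\<close>;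
  expanding these differences into geometric series and summing over \<open>d\<close> yields the claim,
  since \<open>\<delta> q = v\<^sup>2\<close>.
\<close>

subsection \<open>Tree statistics\<close>

definition width :: "nat \<Rightarrow> otree \<Rightarrow> nat" where
  "width d T = card {p \<in> nodes T. length p = d}"

lemma Nil_in_nodes [simp]: "[] \<in> nodes T"
  by (simp add: nodes_def)

lemma Cons_in_nodes [simp]: "i # p \<in> nodes (Node Ts) \<longleftrightarrow> i < length Ts \<and> p \<in> nodes (Ts ! i)"
  by (simp add: nodes_def)

lemma height_le_iff: "height T \<le> Suc d \<longleftrightarrow> (\<forall>p\<in>nodes T. length p \<le> d)"
proof -
  have "level ` nodes T \<noteq> {}" by (auto intro: Nil_in_nodes)
  then show ?thesis
    by (simp add: height_def finite_nodes level_def)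
qed

lemma height_Node_le_iff: "height (Node Ts) \<le> Suc (Suc d) \<longleftrightarrow> (\<forall>T\<in>set Ts. height T \<le> Suc d)"
  by (auto simp: height_le_iff nodes_Node all_set_conv_all_nth)

lemma height_Node_le_1_iff: "height (Node Ts) \<le> Suc 0 \<longleftrightarrow> Ts = []"
proof
  assume le: "height (Node Ts) \<le> Suc 0"
  show "Ts = []"
  proof (rule ccontr)
    assume "Ts \<noteq> []"
    then have "[0] \<in> nodes (Node Ts)" by simp
    with le have "length [0::nat] \<le> 0" unfolding height_le_iff by blast
    then show False by simp
  qed
qed (simp add: height_le_iff nodes_Node)

lemma height_pos: "0 < height T"
proof -
  have "1 \<le> level ([] :: nat list)" by (simp add: level_def)
  also have "\<dots> \<le> height T"
    unfolding height_def by (intro Max_ge imageI) (auto simp: finite_nodes)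
  finally show ?thesis by simp
qed

text \<open>The root adds one to the height and one to the total size of the subtrees. Hence each
  coefficient in \<open>z\<close> involves only finitely many heights.\<close>

lemma height_le_card_nodes: "height T \<le> card (nodes T)"
proof (induction T)
  case (Node Ts)
  have le: "card (nodes (Ts ! i)) \<le> (\<Sum>j<length Ts. card (nodes (Ts ! j)))" if "i < length Ts" for i
    using that member_le_sum[of i "{..<length Ts}" "\<lambda>i. card (nodes (Ts ! i))"] by simp
  have "length p < card (nodes (Ts ! i))" if "i < length Ts" "p \<in> nodes (Ts ! i)" for i p
  proof -
    have "height (Ts ! i) \<le> card (nodes (Ts ! i))" using Node that by simp
    then have "height (Ts ! i) \<le> Suc (card (nodes (Ts ! i)) - 1)"
      by simp
    with that(2) have "length p \<le> card (nodes (Ts ! i)) - 1" unfolding height_le_iff by blast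
    then show ?thesis using card_nodes_pos[of "Ts ! i"] by linarith
  qed
  then have "\<forall>p\<in>nodes (Node Ts). length p \<le> (\<Sum>j<length Ts. card (nodes (Ts ! j)))"
    using le by (force simp: nodes_Node Suc_le_eq intro: less_le_trans)
  then show ?case by (simp add: height_le_iff card_nodes_Node)
qed

lemma card_deepest_nodes:
  assumes "height T = Suc d"
  shows "card (deepest_nodes T) = width d T"
  using assms by (simp add: deepest_nodes_def width_def level_def)

text \<open>Setting \<open>u = 0\<close> will therefore discard exactly the trees that reach level
  \<open>d + 1\<close>.\<close>

lemma width_eq_0_iff:
  assumes "height T \<le> Suc d"
  shows "width d T = 0 \<longleftrightarrow> height T \<le> d"
proof (cases d)
  case 0
  have "height T > 0" by (rule height_pos)
  moreover have "{p \<in> nodes T. length p = 0} = {[]}" by auto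
  ultimately show ?thesis using 0 by (simp add: width_def)
next
  case (Suc e)
  have "width d T = 0 \<longleftrightarrow> (\<forall>p\<in>nodes T. length p \<noteq> d)"
    by (auto simp: width_def finite_nodes)
  also have "\<dots> \<longleftrightarrow> (\<forall>p\<in>nodes T. length p \<le> e)"
    using assms Suc unfolding height_le_iff by (metis le_Suc_eq not_less_eq_eq order_refl)
  finally show ?thesis using Suc by (simp add: height_le_iff)
qed

lemma width_0 [simp]: "width 0 T = 1"
proof -
  have "{p \<in> nodes T. length p = 0} = {[]}" by auto
  then show ?thesis by (simp add: width_def)
qed

lemma width_Suc_Node: "width (Suc d) (Node Ts) = (\<Sum>i<length Ts. width d (Ts ! i))"
proof -
  have "{p \<in> nodes (Node Ts). length p = Suc d}
      = (\<Union>i<length Ts. (#) i ` {p \<in> nodes (Ts ! i). length p = d})"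
    by (auto simp: nodes_Node)
  then have "width (Suc d) (Node Ts)
      = (\<Sum>i<length Ts. card ((#) i ` {p \<in> nodes (Ts ! i). length p = d}))"
    unfolding width_def by (simp only:, intro card_UN_disjoint) (auto simp: finite_nodes)
  also have "\<dots> = (\<Sum>i<length Ts. width d (Ts ! i))"
    by (simp add: width_def card_image)
  finally show ?thesis .
qed

text \<open>Being a last child and being a leaf are decided inside the child subtree that contains
  the upper endpoint of the edge. The only further candidate is the edge from the root to its last
  child.\<close>

lemma markable_edges_Node:
  "markable_edges (Node Ts) = (\<Union>i<length Ts. (#) i ` markable_edges (Ts ! i))
     \<union> {[i] | i. Suc i = length Ts \<and> children (Ts ! i) \<noteq> []}" (is "?L = ?R")
proof (rule set_eqI)
  fix p :: "nat list"
  have leaf1: "is_leaf (Node Ts) (i # q) \<longleftrightarrow> i < length Ts \<and> is_leaf (Ts ! i) q" for i q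
    by (auto simp: is_leaf_def)
  have leaf2: "is_leaf T [] \<longleftrightarrow> children T = []" for T
    by (cases T) (auto simp: is_leaf_def)
  show "p \<in> ?L \<longleftrightarrow> p \<in> ?R"
  proof (cases p)
    case Nil
    then show ?thesis by (auto simp: markable_edges_def)
  next
    case (Cons i q)
    \<comment> \<open>If \<open>q\<close> is empty, the edge leaves the root; otherwise its upper
      endpoint \<open>i # r\<close> lies in child \<open>i\<close>.\<close>
    show ?thesis
    proof (cases q rule: rev_cases)
      case Nil
      have "p \<in> ?L \<longleftrightarrow> i < length Ts \<and> (\<forall>j>i. \<not> j < length Ts) \<and> children (Ts ! i) \<noteq> []"
        using Cons Nil by (auto simp: markable_edges_def leaf1 leaf2)
      also have "\<dots> \<longleftrightarrow> Suc i = length Ts \<and> children (Ts ! i) \<noteq> []"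
        by (metis Suc_lessI lessI not_less_eq)
      also have "\<dots> \<longleftrightarrow> p \<in> ?R"
        using Cons Nil by (auto simp: markable_edges_def)
      finally show ?thesis .
    next
      case (snoc r j)
      have "p \<in> ?L \<longleftrightarrow> i < length Ts \<and> q \<in> markable_edges (Ts ! i)"
        using Cons snoc by (auto simp: markable_edges_def leaf1 Cons_eq_append_conv)
      also have "\<dots> \<longleftrightarrow> p \<in> ?R"
        using Cons snoc by auto
      finally show ?thesis .
    qed
  qed
qed

lemma finite_markable_edges: "finite (markable_edges T)"
  by (rule finite_subset[OF _ finite_nodes[of T]]) (auto simp: markable_edges_def)

lemma Nil_notin_markable_edges: "[] \<notin> markable_edges T"
  by (simp add: markable_edges_def)

lemma card_markable_edges_Node:
  "card (markable_edges (Node Ts)) = (\<Sum>i<length Ts. card (markable_edges (Ts ! i)))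
     + (if Ts \<noteq> [] \<and> children (last Ts) \<noteq> [] then 1 else 0)"
proof -
  let ?R = "{[i] | i. Suc i = length Ts \<and> children (Ts ! i) \<noteq> []}"
  have R: "?R = (if Ts \<noteq> [] \<and> children (last Ts) \<noteq> [] then {[length Ts - 1]} else {})"
    by (cases Ts rule: rev_cases) (auto simp: nth_append)
  have "card (markable_edges (Node Ts))
      = card (\<Union>i<length Ts. (#) i ` markable_edges (Ts ! i)) + card ?R"
    unfolding markable_edges_Node R
    by (intro card_Un_disjoint) (auto simp: finite_markable_edges Nil_notin_markable_edges)
  also have "card (\<Union>i<length Ts. (#) i ` markable_edges (Ts ! i))
      = (\<Sum>i<length Ts. card ((#) i ` markable_edges (Ts ! i)))"
    by (intro card_UN_disjoint) (auto simp: finite_markable_edges)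
  also have "\<dots> = (\<Sum>i<length Ts. card (markable_edges (Ts ! i)))"
    by (simp add: card_image)
  finally show ?thesis unfolding R by simp
qed

lemma card_nodes_Cons: "card (nodes (Node (T # Ts))) = card (nodes T) + card (nodes (Node Ts))"
  by (simp add: card_nodes_Node sum.lessThan_Suc_shift del: sum.lessThan_Suc)

lemma width_Suc_Cons: "width (Suc d) (Node (T # Ts)) = width d T + width (Suc d) (Node Ts)"
  by (simp add: width_Suc_Node sum.lessThan_Suc_shift del: sum.lessThan_Suc)

text \<open>Prepending a subtree on the left keeps the rightmost edge of the root, unless there was
  none. This is why trees are decomposed at their leftmost subtree.\<close>

lemma card_markable_edges_Cons:
  "card (markable_edges (Node (T # Ts))) = card (markable_edges T)
     + card (markable_edges (Node Ts)) + (if Ts = [] \<and> T \<noteq> Node [] then 1 else 0)"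
  by (cases T) (simp add: card_markable_edges_Node sum.lessThan_Suc_shift del: sum.lessThan_Suc)

subsection \<open>Generating functions of trees\<close>

text \<open>The power of 2 counts the sets of marked edges, so \<open>tree_gf (weight u d)\<close>
  is the series \<open>g_d(u)\<close>.\<close>

definition weight :: "'a \<Rightarrow> nat \<Rightarrow> otree \<Rightarrow> 'a::comm_ring_1" where
  "weight u d T =
     (if height T \<le> Suc d then 2 ^ card (markable_edges T) * u ^ width d T else 0)"

lemma weight_leaf: "weight u d (Node []) = (if d = 0 then u else 1)"
  by (cases d) (simp_all add: weight_def height_Node_le_1_iff height_Node_le_iff
      card_markable_edges_Node width_Suc_Node)

lemma weight_0: "weight u 0 T = (if T = Node [] then u else 0)"
  by (cases T) (simp add: weight_leaf, simp add: weight_def height_Node_le_1_iff)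

text \<open>Level \<open>d + 2\<close> of the tree consists of level \<open>d + 1\<close> of
  \<open>T\<close> and level \<open>d + 2\<close> of the rest. The edge to an only child that is not
  a leaf is markable; its factor 2, split as 1 + 1, yields the second product.\<close>

lemma weight_Suc_Cons:
  "weight u (Suc d) (Node (T # Ts)) = weight u d T * weight u (Suc d) (Node Ts)
     + (if T = Node [] then 0 else weight u d T) * (if Node Ts = Node [] then 1 else 0)"
proof (cases "Ts = []")
  case True
  have "width (Suc d) (Node []) = 0" "card (markable_edges (Node [])) = 0"
    by (simp_all add: width_Suc_Node card_markable_edges_Node)
  then have "weight u (Suc d) (Node [T]) = (if T = Node [] then 1 else 2) * weight u d T"
    by (simp add: weight_def height_Node_le_iff card_markable_edges_Cons width_Suc_Cons)
  moreover have "weight u (Suc d) (Node []) = 1"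
    by (simp add: weight_leaf)
  ultimately show ?thesis
    using True by simp
next
  case False
  then show ?thesis
    by (auto simp: weight_def height_Node_le_iff card_markable_edges_Cons width_Suc_Cons power_add)
qed

definition tree_gf :: "(otree \<Rightarrow> 'a) \<Rightarrow> 'a::comm_ring_1 fps" where
  "tree_gf w = Abs_fps (\<lambda>n. \<Sum>T | card (nodes T) = n. w T)"

lemma finite_otrees: "finite {T. card (nodes T) = n}"
  by (rule finite_subset[OF _ finite_otrees_le[of n]]) auto

lemma tree_gf_add: "tree_gf (\<lambda>T. a T + b T) = tree_gf a + tree_gf b"
  by (rule fps_ext) (simp add: tree_gf_def sum.distrib)

lemma tree_gf_diff: "tree_gf (\<lambda>T. a T - b T) = tree_gf a - tree_gf b"
  by (rule fps_ext) (simp add: tree_gf_def sum_subtractf)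

lemma tree_gf_leaf: "tree_gf (\<lambda>T. if T = Node [] then c T else 0) = fps_X * fps_const (c (Node []))"
proof (rule fps_ext)
  fix n
  have "(\<Sum>T | card (nodes T) = n. if T = Node [] then c T else 0)
      = (if n = 1 then c (Node []) else 0)"
    by (subst sum.delta) (auto simp: finite_otrees card_nodes_Node)
  then show "fps_nth (tree_gf (\<lambda>T. if T = Node [] then c T else 0)) n
      = fps_nth (fps_X * fps_const (c (Node []))) n"
    by (simp add: tree_gf_def)
qed

lemma tree_gf_mult_nth:
  "fps_nth (tree_gf a * tree_gf b) n
     = (\<Sum>(T, S) | card (nodes T) + card (nodes S) = n. a T * b S)"
proof -
  have "fps_nth (tree_gf a * tree_gf b) n
      = (\<Sum>k\<le>n. \<Sum>(T, S)\<in>{T. card (nodes T) = k} \<times> {S. card (nodes S) = n - k}. a T * b S)"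
    by (simp add: fps_mult_nth tree_gf_def sum_product sum.cartesian_product atLeast0AtMost)
  also have "\<dots> = (\<Sum>(T, S)\<in>(\<Union>k\<le>n. {T. card (nodes T) = k} \<times> {S. card (nodes S) = n - k}). a T * b S)"
    by (rule sum.UNION_disjoint[symmetric]) (auto simp: finite_otrees)
  also have "(\<Union>k\<le>n. {T. card (nodes T) = k} \<times> {S. card (nodes S) = n - k})
      = {(T, S). card (nodes T) + card (nodes S) = n}"
    by auto
  finally show ?thesis .
qed

text \<open>Splitting off the leftmost subtree is a bijection from trees with an edge to pairs of
  trees; sizes add up because the second tree keeps the root.\<close>

lemma tree_gf_Cons:
  assumes w: "\<And>T Ts. w (Node (T # Ts)) = a T * b (Node Ts) + a' T * b' (Node Ts)"
  shows "tree_gf w = fps_X * fps_const (w (Node [])) + tree_gf a * tree_gf b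
           + tree_gf a' * tree_gf b'"
proof -
  let ?f = "\<lambda>T. if T = Node [] then w T else 0" and ?g = "\<lambda>T. if T = Node [] then 0 else w T"
  \<comment> \<open>\<open>J\<close> grafts \<open>T\<close> as leftmost subtree onto the root of
    \<open>S\<close>; its image misses only the one-node tree.\<close>
  define J where "J = (\<lambda>(T, S). Node (T # children S))"
  have g: "fps_nth (tree_gf ?g) n = fps_nth (tree_gf a * tree_gf b + tree_gf a' * tree_gf b') n" for n
  proof -
    let ?P = "{(T, S). card (nodes T) + card (nodes S) = n}"
    have inj: "inj_on J ?P"
      by (auto simp: inj_on_def J_def otree.expand)
    have size: "card (nodes (J (T, S))) = card (nodes T) + card (nodes S)" for T S
      by (simp add: J_def card_nodes_Cons)
    have "fps_nth (tree_gf ?g) n = (\<Sum>T | card (nodes T) = n. ?g T)"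
      by (simp add: tree_gf_def)
    also have "\<dots> = (\<Sum>T\<in>J ` ?P. ?g T)"
    proof (rule sum.mono_neutral_right)
      show "finite {T. card (nodes T) = n}" by (rule finite_otrees)
      show "J ` ?P \<subseteq> {T. card (nodes T) = n}" using size by auto
      show "\<forall>T\<in>{T. card (nodes T) = n} - J ` ?P. ?g T = 0"
      proof
        fix T assume T: "T \<in> {T. card (nodes T) = n} - J ` ?P"
        show "?g T = 0"
        proof (cases "children T")
          case Nil
          then show ?thesis by (cases T) simp
        next
          case (Cons S Ss)
          then have "T = J (S, Node Ss)" by (cases T) (simp add: J_def)
          with T size[of S "Node Ss"] show ?thesis by auto
        qed
      qed
    qed
    also have "\<dots> = (\<Sum>p\<in>?P. ?g (J p))"
      using sum.reindex[OF inj, of ?g] by simp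
    also have "\<dots> = (\<Sum>(T, S)\<in>?P. a T * b S + a' T * b' S)"
      by (intro sum.cong) (auto simp: J_def w)
    also have "\<dots> = (\<Sum>(T, S)\<in>?P. a T * b S) + (\<Sum>(T, S)\<in>?P. a' T * b' S)"
      by (simp add: sum.distrib case_prod_beta)
    also have "\<dots> = fps_nth (tree_gf a * tree_gf b + tree_gf a' * tree_gf b') n"
      by (simp add: tree_gf_mult_nth)
    finally show ?thesis .
  qed
  have "tree_gf w = tree_gf (\<lambda>T. ?f T + ?g T)"
    by (rule arg_cong[of _ _ tree_gf]) auto
  also have "\<dots> = tree_gf ?f + tree_gf ?g" by (rule tree_gf_add)
  also have "tree_gf ?g = tree_gf a * tree_gf b + tree_gf a' * tree_gf b'"
    using g by (rule fps_ext)
  finally show ?thesis by (simp add: tree_gf_leaf add.assoc)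
qed

lemma tree_gf_weight_0: "tree_gf (weight u 0) = fps_X * fps_const u"
  unfolding weight_0[abs_def] using tree_gf_leaf[of "\<lambda>_. u"] by simp

text \<open>The last product counts the extra choice of marking an edge to an only child. Leaves are
  subtracted because edges to them cannot be marked.\<close>

lemma tree_gf_weight_Suc:
  "tree_gf (weight u (Suc d)) = fps_X + tree_gf (weight u d) * tree_gf (weight u (Suc d))
     + (tree_gf (weight u d) - fps_X * fps_const (if d = 0 then u else 1)) * fps_X"
proof -
  have "(\<lambda>T. if T = Node [] then 0 else weight u d T)
      = (\<lambda>T. weight u d T - (if T = Node [] then weight u d T else 0))" by auto
  then have *: "tree_gf (\<lambda>T. if T = Node [] then 0 else weight u d T)
      = tree_gf (weight u d) - fps_X * fps_const (if d = 0 then u else 1)"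
    by (simp add: tree_gf_diff tree_gf_leaf weight_leaf cong: if_cong)
  have **: "tree_gf (\<lambda>T. if T = Node [] then 1 else 0 :: 'a) = fps_X"
    using tree_gf_leaf[of "\<lambda>_. 1 :: 'a"] by simp
  show ?thesis
    by (rule trans[OF tree_gf_Cons[of "weight u (Suc d)", OF weight_Suc_Cons]])
      (simp add: * ** weight_leaf)
qed

text \<open>For \<open>d = 0\<close> only the leaf has nonzero weight, so the marking term vanishes.
  This first step is not an instance of the Moebius map.\<close>

lemma tree_gf_weight_1: "tree_gf (weight u (Suc 0)) * (1 - fps_X * fps_const u) = fps_X"
proof -
  have "tree_gf (weight u (Suc 0)) = fps_X + fps_X * fps_const u * tree_gf (weight u (Suc 0))"
    by (rule trans[OF tree_gf_weight_Suc[of u 0]]) (simp add: tree_gf_weight_0)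
  then have "tree_gf (weight u (Suc 0)) - fps_X * fps_const u * tree_gf (weight u (Suc 0)) = fps_X"
    by (simp only: diff_eq_eq)
  then show ?thesis by (simp add: algebra_simps)
qed

lemma tree_gf_weight_Suc_Suc:
  "tree_gf (weight u (Suc (Suc d))) * (1 - tree_gf (weight u (Suc d)))
     = fps_X * (1 + tree_gf (weight u (Suc d)) - fps_X)"
proof -
  have "tree_gf (weight u (Suc (Suc d))) = fps_X
      + tree_gf (weight u (Suc d)) * tree_gf (weight u (Suc (Suc d)))
      + (tree_gf (weight u (Suc d)) - fps_X) * fps_X" (is "?h = fps_X + ?g * ?h + (?g - fps_X) * fps_X")
    by (rule trans[OF tree_gf_weight_Suc[of u "Suc d"]]) simp
  then have "?h - ?g * ?h = fps_X + (?g - fps_X) * fps_X"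
    by (simp only: diff_eq_eq add_ac)
  then show ?thesis by (simp add: algebra_simps)
qed

text \<open>Only \<open>d + 1 = height T\<close> contributes. For smaller \<open>d\<close> both
  weights are 0; for larger \<open>d\<close> level \<open>d + 1\<close> is empty and both bases have
  exponent 0; in between, \<open>0 ^ width d T\<close> vanishes.\<close>

lemma sum_weight_diff:
  assumes "height T \<le> Suc n"
  shows "(\<Sum>d\<le>n. weight u d T - weight 0 d T)
           = 2 ^ card (markable_edges T) * u ^ card (deepest_nodes T)"
proof -
  obtain h where h: "height T = Suc h" using height_pos[of T] by (cases "height T") auto
  have "weight u d T - weight 0 d T
      = (if d = h then 2 ^ card (markable_edges T) * u ^ card (deepest_nodes T) else 0)" for d
  proof -
    consider "d < h" | "d = h" | "d > h" by linarith
    then show ?thesis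
    proof cases
      case 1
      then show ?thesis using h by (simp add: weight_def)
    next
      case 2
      have "width h T \<noteq> 0" using width_eq_0_iff[of T h] h by simp
      then show ?thesis using h 2 card_deepest_nodes[OF h] by (simp add: weight_def power_0_left)
    next
      case 3
      have "width d T = 0" using width_eq_0_iff[of T d] h 3 by simp
      then show ?thesis using 3 by (simp add: weight_def)
    qed
  qed
  then show ?thesis using assms h by (simp add: sum.delta)
qed

section \<open>Marked trees as a weighted sum over trees\<close>

lemma num_marked_otrees_eq:
  "num_marked_otrees n i
     = (\<Sum>T | card (nodes T) = n \<and> card (deepest_nodes T) = i. 2 ^ card (markable_edges T))"
proof -
  have "{(T, M) \<in> marked_otrees. card (nodes T) = n \<and> card (deepest_nodes T) = i}
      = (SIGMA T:{T. card (nodes T) = n \<and> card (deepest_nodes T) = i}. Pow (markable_edges T))"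
    by (auto simp: marked_otrees_def)
  moreover have "finite {T. card (nodes T) = n \<and> card (deepest_nodes T) = i}"
    by (rule finite_subset[OF _ finite_otrees[of n]]) auto
  ultimately show ?thesis
    by (simp add: num_marked_otrees_def card_SigmaI finite_markable_edges card_Pow)
qed

lemma fps_to_fls_sum: "fps_to_fls (\<Sum>x\<in>A. f x) = (\<Sum>x\<in>A. fps_to_fls (f x))"
  by (induction A rule: infinite_finite_induct) auto

text \<open>The outer variable is \<open>z\<close> and the inner \<open>fls_X\<close> is
  \<open>t\<close>; each coefficient in \<open>z\<close> is a polynomial in
  \<open>t\<close>.\<close>

lemma ser_G_eq_tree_gf:
  "ser_G = fps_to_fls (tree_gf (\<lambda>T. 2 ^ card (markable_edges T) * fls_X ^ card (deepest_nodes T)))"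
proof -
  have "Abs_fps (\<lambda>i. of_nat (num_marked_otrees n i) :: real)
      = (\<Sum>T | card (nodes T) = n. 2 ^ card (markable_edges T) * fps_X ^ card (deepest_nodes T))" for n
  proof (rule fps_ext)
    fix i
    have "fps_nth (\<Sum>T | card (nodes T) = n. 2 ^ card (markable_edges T) * fps_X ^ card (deepest_nodes T)) i
       = (\<Sum>T | card (nodes T) = n. if card (deepest_nodes T) = i then 2 ^ card (markable_edges T) else 0 :: real)"
      by (simp add: fps_sum_nth fps_X_power_nth fps_mult_right_const_nth numeral_fps_const
            fps_const_power if_distrib eq_commute cong: if_cong)
    also have "\<dots> = (\<Sum>T | card (nodes T) = n \<and> card (deepest_nodes T) = i. 2 ^ card (markable_edges T))"
      by (subst sum.inter_filter[symmetric]) (auto simp: finite_otrees)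
    finally show "fps_nth (Abs_fps (\<lambda>i. of_nat (num_marked_otrees n i) :: real)) i
       = fps_nth (\<Sum>T | card (nodes T) = n. 2 ^ card (markable_edges T) * fps_X ^ card (deepest_nodes T)) i"
      by (simp add: num_marked_otrees_eq)
  qed
  then show ?thesis
    by (simp add: ser_G_def tree_gf_def fps_to_fls_sum fls_times_fps_to_fls fps_to_fls_power)
qed

subsection \<open>Order of Laurent series\<close>

text \<open>The zero series satisfies every such bound, whereas its \<open>fls_subdegree\<close> is
  0 by convention; sums then need no case distinction.\<close>

definition order_ge :: "int \<Rightarrow> 'a::field fls \<Rightarrow> bool" where
  "order_ge n f \<longleftrightarrow> (\<forall>k<n. fls_nth f k = 0)"

lemma order_ge_iff: "order_ge n f \<longleftrightarrow> f = 0 \<or> n \<le> fls_subdegree f"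
  unfolding order_ge_def by (meson fls_eq0_below_subdegree fls_subdegree_geI fls_zero_nth less_le_trans)

lemma order_ge_zero [simp]: "order_ge n 0"
  and order_ge_one: "order_ge 0 1"
  and order_ge_const: "order_ge 0 (fls_const c)"
  and order_ge_numeral: "order_ge 0 (numeral m)"
  and order_ge_of_nat: "order_ge 0 (of_nat k)"
  and order_ge_fls_X: "order_ge 1 fls_X"
  by (auto simp: order_ge_iff)

lemma order_ge_mono: "order_ge n f \<Longrightarrow> m \<le> n \<Longrightarrow> order_ge m f"
  by (auto simp: order_ge_def)

lemma order_ge_add: "order_ge n f \<Longrightarrow> order_ge n g \<Longrightarrow> order_ge n (f + g)"
  and order_ge_diff: "order_ge n f \<Longrightarrow> order_ge n g \<Longrightarrow> order_ge n (f - g)"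
  and order_ge_uminus: "order_ge n f \<Longrightarrow> order_ge n (- f)"
  by (auto simp: order_ge_def)

lemma order_ge_sum: "(\<And>x. x \<in> A \<Longrightarrow> order_ge n (f x)) \<Longrightarrow> order_ge n (sum f A)"
  by (induction A rule: infinite_finite_induct) (auto intro: order_ge_add)

lemma order_ge_mult: "order_ge m f \<Longrightarrow> order_ge n g \<Longrightarrow> order_ge (m + n) (f * g)"
  by (cases "f = 0 \<or> g = 0") (auto simp: order_ge_iff)

lemma order_ge_mult_left: "order_ge n f \<Longrightarrow> order_ge 0 g \<Longrightarrow> order_ge n (f * g)"
  using order_ge_mult[of n f 0 g] by simp

lemma order_ge_mult_right: "order_ge 0 f \<Longrightarrow> order_ge n g \<Longrightarrow> order_ge n (f * g)"
  using order_ge_mult[of 0 f n g] by simp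

lemma order_ge_power: "order_ge n f \<Longrightarrow> order_ge (int k * n) (f ^ k)"
  by (induction k) (auto simp: order_ge_one algebra_simps intro: order_ge_mult)

lemma order_ge_power_1: "order_ge 1 f \<Longrightarrow> order_ge (int k) (f ^ k)"
  using order_ge_power[of 1 f k] by simp

lemma order_ge_power_0: "order_ge 0 f \<Longrightarrow> order_ge 0 (f ^ k)"
  using order_ge_power[of 0 f k] by simp

lemma one_minus_nonzero: "order_ge 1 f \<Longrightarrow> 1 - f \<noteq> 0"
  by (auto simp: order_ge_iff)

lemma order_ge_inverse_one_minus:
  assumes "order_ge 1 f"
  shows "order_ge 0 (inverse (1 - f))"
proof -
  have "fls_subdegree (1 - f) = 0"
    using assms by (intro fls_subdegree_eqI) (auto simp: order_ge_def)
  then show ?thesis by (simp add: order_ge_iff)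
qed

lemma order_ge_divide_one_minus: "order_ge n g \<Longrightarrow> order_ge 1 f \<Longrightarrow> order_ge n (g / (1 - f))"
  unfolding divide_inverse by (intro order_ge_mult_left order_ge_inverse_one_minus)

section \<open>Infinite sums in the z-adic metric\<close>

lemma dist_le_of_order_ge:
  assumes "order_ge (int n) (a - b)"
  shows "dist a b \<le> inverse (2 ^ n)"
proof (cases "a = b")
  case False
  with assms have "int n \<le> fls_subdegree (a - b)" by (simp add: order_ge_iff)
  moreover from this have "(2::real) ^ n \<le> 2 ^ nat (fls_subdegree (a - b))"
    by (intro power_increasing) auto
  ultimately show ?thesis using False by (simp add: dist_fls_def)
qed simp

text \<open>By the ultrametric property, finitely many indices added to \<open>X n\<close> change
  the sum only in order at least \<open>n\<close>, however many they are.\<close>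

lemma fls_has_sumI:
  fixes F :: "'b \<Rightarrow> 'a::field fls"
  assumes X: "\<And>n. finite (X n)" "\<And>n. X n \<subseteq> I"
    and S: "\<And>n. order_ge (int n) (S - sum F (X n))"
    and F: "\<And>n x. x \<in> I \<Longrightarrow> x \<notin> X n \<Longrightarrow> order_ge (int n) (F x)"
  shows "(F has_sum S) I"
  unfolding has_sum_def
proof (rule tendstoI)
  fix e :: real assume "e > 0"
  then obtain n where n: "inverse (2 ^ n) < e"
    using real_arch_pow_inv[of e "1/2"] by (auto simp: power_one_over inverse_eq_divide)
  have less: "dist (sum F Y) S < e" if Y: "finite Y" "X n \<subseteq> Y" "Y \<subseteq> I" for Y
  proof -
    have "sum F Y - S = sum F (Y - X n) - (S - sum F (X n))"
      using Y by (simp add: sum_diff algebra_simps)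
    moreover have "order_ge (int n) (sum F (Y - X n))"
      using Y by (intro order_ge_sum F) auto
    ultimately have "order_ge (int n) (sum F Y - S)"
      by (simp only:) (intro order_ge_diff S)
    then show ?thesis using dist_le_of_order_ge[of n "sum F Y" S] n by simp
  qed
  show "eventually (\<lambda>Y. dist (sum F Y) S < e) (finite_subsets_at_top I)"
    unfolding eventually_finite_subsets_at_top
    by (rule exI[of _ "X n"]) (simp add: X less)
qed

subsection \<open>The iterated Moebius map\<close>

text \<open>The exact remainder keeps all later rearrangements finite. The constant term stands
  apart because it cancels in differences.\<close>

lemma geometric_remainder:
  fixes x :: "'a::field"
  assumes "x \<noteq> 1"
  shows "1 / (1 - x) = 1 + (\<Sum>k=1..n. x ^ k) + x ^ Suc n / (1 - x)"
proof (induction n)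
  case 0
  then show ?case using assms by (simp add: field_simps)
next
  case (Suc n)
  then show ?case using assms by (simp add: field_simps)
qed

text \<open>Only the quadratic equation and the positive order of \<open>v\<close> are used, not the
  square root. The coefficient field is left general so that \<open>t\<close> can be one of its
  elements.\<close>

locale marked_tree_series =
  fixes v :: "'a::field_char_0 fls"
  assumes v_eq: "fls_X * (1 + 3 * v + v ^ 2) = v" and order_v: "order_ge 1 v"
begin

definition q where "q = v * (v + 2) / (2 * v + 1)"

definition M where "M = fls_X * (1 + v)"

definition M' where "M' = fls_X * (1 + v) / v"

definition A where "A = fls_X * (v\<^sup>2 - 1) / v"

definition y where "y u = fls_const u * (1 + v) * fls_X"

definition U where "U u = (v - 1) / v * (y u / (1 - y u))"

definition g where "g u d = fps_to_fls (tree_gf (weight u d))"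

section \<open>Orders of the auxiliary series\<close>

lemma v_eq': "fls_X * (1 + 3 * v + v ^ 2) - v = 0"
  using v_eq by simp

lemma v_nonzero: "v \<noteq> 0"
  using v_eq by auto

lemma order_v0: "order_ge 0 v"
  using order_v by (rule order_ge_mono) simp

lemma two_v_plus_1_nonzero: "2 * v + 1 \<noteq> 0"
proof -
  have "order_ge 1 (- (2 * v))"
    by (intro order_ge_uminus order_ge_mult_right order_v order_ge_numeral)
  then show ?thesis using one_minus_nonzero[of "- (2 * v)"] by (simp add: add.commute)
qed

lemma v_plus_2_nonzero: "v + 2 \<noteq> 0"
proof
  assume "v + 2 = 0"
  then have "v = - 2" by (simp add: eq_neg_iff_add_eq_0)
  with order_v show False by (simp add: order_ge_iff)
qed

lemma order_q: "order_ge 1 q"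
proof -
  have "order_ge 1 (v * (v + 2) / (1 - (- (2 * v))))"
    by (intro order_ge_divide_one_minus order_ge_uminus order_ge_mult_right[OF order_ge_numeral]
        order_ge_mult_left order_ge_add order_v order_v0 order_ge_numeral)
  then show ?thesis by (simp add: q_def add.commute)
qed

lemma order_y: "order_ge 1 (y u)"
  unfolding y_def
  by (intro order_ge_mult_right order_ge_fls_X order_ge_const order_ge_add order_ge_one order_v0)

lemma order_3v: "order_ge 1 (- (3 * v + v ^ 2))"
  unfolding power2_eq_square
  by (intro order_ge_uminus order_ge_add order_ge_mult_right order_v order_v0 order_ge_numeral)

text \<open>By the quadratic equation this is the inverse of \<open>1 + 3 * v + v ^ 2\<close>, a
  unit. It compensates the division by \<open>v\<close> in \<open>U\<close> and
  \<open>A\<close>.\<close>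

lemma order_z_div_v: "order_ge 0 (fls_X / v)"
proof -
  have nz: "1 + 3 * v + v ^ 2 \<noteq> 0"
    using v_eq v_nonzero by auto
  have "fls_X / v = fls_X / (fls_X * (1 + 3 * v + v ^ 2))" by (simp add: v_eq)
  also have "\<dots> = inverse (1 - (- (3 * v + v ^ 2)))"
    using nz by (simp add: inverse_eq_divide add.assoc)
  finally show ?thesis using order_ge_inverse_one_minus[OF order_3v] by (simp only:)
qed

lemma order_U: "order_ge 0 (U u)"
proof -
  have "U u = (v - 1) * (fls_const u * (1 + v) * (fls_X / v) / (1 - y u))"
    by (simp add: U_def y_def)
  then show ?thesis
    by (simp only:, intro order_ge_mult_right order_ge_diff order_v0 order_ge_one
        order_ge_divide_one_minus order_y order_z_div_v order_ge_const order_ge_add)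
qed

lemma order_v_sq: "order_ge 1 (v\<^sup>2)"
  unfolding power2_eq_square by (intro order_ge_mult_right order_v order_v0)

lemma order_A: "order_ge 0 A"
proof -
  have "A = (fls_X / v) * (v\<^sup>2 - 1)" by (simp add: A_def)
  then show ?thesis
    by (simp only:, intro order_ge_mult_right order_z_div_v order_ge_diff order_ge_one
       order_ge_mono[OF order_v_sq]) simp
qed

lemma v_sq_nonzero: "1 - v\<^sup>2 \<noteq> 0"
  by (rule one_minus_nonzero[OF order_v_sq])

lemma A_nonzero: "A \<noteq> 0"
  using v_nonzero v_sq_nonzero by (simp add: A_def)

text \<open>The quadratic equation cancels \<open>fls_X\<close> and leaves the unit
  \<open>v\<^sup>2 - 1\<close> in the denominator. Division by \<open>A\<close> thus preserves order
  bounds.\<close>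

lemma order_inverse_A: "order_ge 0 (inverse A)"
proof -
  have "inverse A = v / (fls_X * (v\<^sup>2 - 1))"
    by (simp add: A_def)
  also have "v / (fls_X * (v\<^sup>2 - 1)) = fls_X * (1 + 3 * v + v ^ 2) / (fls_X * (v\<^sup>2 - 1))"
    by (simp only: v_eq)
  also have "\<dots> = (1 + 3 * v + v ^ 2) / (v\<^sup>2 - 1)" by simp
  also have "\<dots> = - ((1 + 3 * v + v ^ 2) / (1 - v\<^sup>2))"
    by (metis minus_diff_eq minus_divide_right)
  finally show ?thesis
    by (simp only:, intro order_ge_uminus order_ge_divide_one_minus order_v_sq order_ge_add
       order_ge_one order_ge_mult_right[OF order_ge_numeral] order_v0 order_ge_power_0)
qed

lemma order_g: "order_ge 1 (g u d)"
proof -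
  have "fls_nth (g u d) k = 0" if "k < 1" for k
    using that by (cases "k = 0") (auto simp: g_def tree_gf_def card_nodes_nonzero)
  then show ?thesis by (simp add: order_ge_def)
qed

lemma g_0: "g u 0 = fls_X * fls_const u"
  by (simp add: g_def tree_gf_weight_0 fls_times_fps_to_fls)

lemma g_1: "g u (Suc 0) * (1 - fls_X * fls_const u) = fls_X"
  using arg_cong[OF tree_gf_weight_1[of u], of fps_to_fls]
  by (simp add: g_def fls_times_fps_to_fls)

lemma g_Suc: "g u (Suc (Suc d)) * (1 - g u (Suc d)) = fls_X * (1 + g u (Suc d) - fls_X)"
  using arg_cong[OF tree_gf_weight_Suc_Suc[of u d], of fps_to_fls]
  by (simp add: g_def fls_times_fps_to_fls)

section \<open>Fixed points and multiplier of the Moebius map\<close>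

lemma M'_v: "M' * v = M"
  using v_nonzero by (simp add: M'_def M_def)

text \<open>This is \<open>M * (1 - M) = fls_X * (1 + M - fls_X)\<close> rearranged; in terms of
  \<open>v\<close> it is \<open>fls_X\<close> times the quadratic equation.\<close>

lemma M_fixed: "(fls_X + M) * M = fls_X\<^sup>2 - fls_X + M"
  using v_eq' unfolding M_def by algebra

text \<open>Vieta's formula for the fixed-point equation
  \<open>x^2 - (1 - z) x + z - z^2 = 0\<close>; it makes \<open>M'\<close> the second root.\<close>

lemma M_plus_M': "M + M' = 1 - fls_X"
proof -
  have "(M + M') * v = (1 - fls_X) * v"
    using v_eq' M'_v unfolding M_def by algebra
  then show ?thesis using v_nonzero by simp
qed

lemma M'_fixed: "(fls_X + M') * M' = fls_X\<^sup>2 - fls_X + M'"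
  using M_fixed M_plus_M' by algebra

text \<open>The Moebius map multiplies \<open>(G - M) / (G - M')\<close> by
  \<open>(z + M) / (z + M')\<close>.\<close>

lemma q_multiplier: "fls_X + M = q * (fls_X + M')"
proof -
  have q: "q * (2 * v + 1) = v * (v + 2)"
    using two_v_plus_1_nonzero by (simp add: q_def)
  have "(fls_X + M) * v = q * (fls_X + M') * v"
    using q M'_v unfolding M_def by algebra
  then show ?thesis using v_nonzero by simp
qed

text \<open>Divided by \<open>1 - y u\<close>, the right-hand side is the initial ratio
  \<open>(g_1 - M) / (g_1 - M')\<close>.\<close>

lemma U_eq: "v\<^sup>2 * (1 + U u) * (1 - y u) = v * (v - y u)"
  using one_minus_nonzero[OF order_y[of u]] v_nonzero
  by (simp add: U_def power2_eq_square) (simp add: field_simps)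

text \<open>The ratio of the differences to the two fixed points gains a factor \<open>q\<close> per
  step. The product form avoids dividing by \<open>g u (Suc d) - M'\<close>.\<close>

lemma g_moebius:
  "g u (Suc d) - M = q ^ d * (v\<^sup>2 * (1 + U u)) * (g u (Suc d) - M')"
proof (induction d)
  case 0
  define R where "R = v\<^sup>2 * (1 + U u)"
  define s where "s = 1 - fls_X * fls_const u"
  have s: "s \<noteq> 0"
    unfolding s_def by (intro one_minus_nonzero order_ge_mult_left order_ge_fls_X order_ge_const)
  have R: "R * (1 - y u) = v * (v - y u)"
    unfolding R_def by (rule U_eq)
  have gs: "g u (Suc 0) * s - fls_X = 0" unfolding s_def by (simp add: g_1)
  have y: "y u - (1 - s) * (1 + v) = 0" by (simp add: y_def s_def)
  have 1: "(g u (Suc 0) - M) * s = fls_X * (y u - v)"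
    using gs y unfolding M_def by algebra
  have 2: "(g u (Suc 0) - M') * s * v = fls_X * (y u - 1)"
    using gs y M'_v unfolding M_def by algebra
  have "(g u (Suc 0) - M) * (s * v) = R * (g u (Suc 0) - M') * (s * v)"
    using 1 2 R by algebra
  then show ?case using s v_nonzero by (simp add: R_def)
next
  case (Suc d)
  define G H where "G = g u (Suc d)" and "H = g u (Suc (Suc d))"
  define \<rho> where "\<rho> = q ^ d * (v\<^sup>2 * (1 + U u))"
  have IH: "G - M = \<rho> * (G - M')" unfolding G_def \<rho>_def by (rule Suc)
  have H: "H * (1 - G) = fls_X * (1 + G - fls_X)"
    unfolding H_def G_def by (rule g_Suc)
  \<comment> \<open>The fixed-point equation turns the constant term
    \<open>fls_X\<^sup>2 - fls_X + M\<close> into \<open>(fls_X + M) * M\<close>, so that the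
    right-hand side factors.\<close>
  have 1: "(H - M) * (1 - G) = (fls_X + M) * (G - M)"
    using H M_fixed by algebra
  have 2: "(H - M') * (1 - G) = (fls_X + M') * (G - M')"
    using H M'_fixed by algebra
  have "(H - M) * (1 - G) = (q * \<rho> * (H - M')) * (1 - G)"
    using 1 2 IH q_multiplier by algebra
  moreover have "1 - G \<noteq> 0" unfolding G_def by (rule one_minus_nonzero[OF order_g])
  ultimately have "H - M = q * \<rho> * (H - M')" by simp
  then show ?case by (simp add: H_def \<rho>_def mult.assoc)
qed

lemma A_eq: "A = M - M'"
  using v_nonzero by (simp add: A_def M_def M'_def field_simps power2_eq_square)

lemma order_rho: "order_ge 1 (q ^ d * (v\<^sup>2 * (1 + U u)))"
  by (intro order_ge_mult_right order_ge_mult_left order_v_sq order_ge_add order_ge_one order_U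
     order_ge_power_0 order_ge_mono[OF order_q]) simp

lemma g_closed_form: "g u (Suc d) = M' + A / (1 - q ^ d * (v\<^sup>2 * (1 + U u)))"
proof -
  define \<rho> where "\<rho> = q ^ d * (v\<^sup>2 * (1 + U u))"
  have "g u (Suc d) - M = \<rho> * (g u (Suc d) - M')"
    unfolding \<rho>_def by (rule g_moebius)
  then have "(g u (Suc d) - M') * (1 - \<rho>) = A"
    using A_eq by algebra
  moreover have "1 - \<rho> \<noteq> 0"
    unfolding \<rho>_def by (rule one_minus_nonzero[OF order_rho])
  ultimately have "g u (Suc d) - M' = A / (1 - \<rho>)"
    by (simp add: eq_divide_eq)
  then show ?thesis by (simp add: \<rho>_def diff_eq_eq add.commute)
qed

section \<open>Geometric expansion and summation over the height\<close>

lemma U_0: "U 0 = 0"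
  by (simp add: U_def y_def)

text \<open>Up to the factor \<open>1 / (1 - q ^ k)\<close> this is the inner sum over
  \<open>i\<close> in the theorem; the subtracted 1 is the term \<open>i = 0\<close>, contributed by
  \<open>u = 0\<close>.\<close>

definition term_sum :: "'a \<Rightarrow> nat \<Rightarrow> 'a fls" where
  "term_sum u k = (v\<^sup>2) ^ k * ((1 + U u) ^ k - 1)"

lemma order_term_sum: "order_ge (int k) (term_sum u k)"
  unfolding term_sum_def
  by (intro order_ge_mult_left order_ge_power_1 order_v_sq order_ge_diff order_ge_power_0
      order_ge_add order_ge_one order_U)

text \<open>Both closed forms are expanded up to exponent \<open>n\<close>. The constants cancel,
  and each remainder contains the power \<open>n + 1\<close> of a series of positive order.\<close>

lemma g_diff_approx:
  "\<exists>E. order_ge (int n) E \<and>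
     g u (Suc d) - g 0 (Suc d) = A * ((\<Sum>k=1..n. (q ^ k) ^ d * term_sum u k) + E)"
proof -
  define \<rho> where "\<rho> w = q ^ d * (v\<^sup>2 * (1 + U w))" for w
  define E where "E w = \<rho> w ^ Suc n / (1 - \<rho> w)" for w
  have ord: "order_ge 1 (\<rho> w)" for w unfolding \<rho>_def by (rule order_rho)
  have "order_ge (int n) (E w)" for w
    unfolding E_def
    by (intro order_ge_divide_one_minus ord order_ge_mono[OF order_ge_power_1]) simp
  then have 1: "order_ge (int n) (E u - E 0)" by (intro order_ge_diff)
  have rho1: "\<rho> w \<noteq> 1" for w using one_minus_nonzero[OF ord[of w]] by auto
  have "g u (Suc d) - g 0 (Suc d) = A * (1 / (1 - \<rho> u) - 1 / (1 - \<rho> 0))"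
    unfolding g_closed_form \<rho>_def by (simp add: right_diff_distrib)
  also have "1 / (1 - \<rho> u) - 1 / (1 - \<rho> 0) = (\<Sum>k=1..n. \<rho> u ^ k) - (\<Sum>k=1..n. \<rho> 0 ^ k) + (E u - E 0)"
    unfolding geometric_remainder[OF rho1, of _ n] E_def by simp
  also have "(\<Sum>k=1..n. \<rho> u ^ k) - (\<Sum>k=1..n. \<rho> 0 ^ k) = (\<Sum>k=1..n. (q ^ k) ^ d * term_sum u k)"
    unfolding sum_subtractf[symmetric]
    by (intro sum.cong refl)
      (simp add: \<rho>_def U_0 term_sum_def power_mult_distrib right_diff_distrib mult_ac
        flip: power_mult)
  finally show ?thesis using 1 by blast
qed

lemma order_q_power: "0 < k \<Longrightarrow> order_ge 1 (q ^ k)"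
  by (rule order_ge_mono[OF order_ge_power_1[OF order_q]]) simp

text \<open>Interchanging the sums gives a finite geometric series in \<open>d\<close> for each
  \<open>k\<close>. Its defect contains \<open>q ^ (k * n)\<close>, of order at least
  \<open>n\<close> since \<open>k\<close> is positive.\<close>

lemma sum_g_diff_approx:
  "order_ge (int n) ((\<Sum>d<n. g u (Suc d) - g 0 (Suc d))
     - A * (\<Sum>k=1..n. term_sum u k / (1 - q ^ k)))"
proof -
  obtain E where E: "order_ge (int n) (E d)"
    and g: "g u (Suc d) - g 0 (Suc d) = A * ((\<Sum>k=1..n. (q ^ k) ^ d * term_sum u k) + E d)" for d
    using g_diff_approx[of n u] by metis
  have "(\<Sum>d<n. g u (Suc d) - g 0 (Suc d))
      = A * ((\<Sum>d<n. \<Sum>k=1..n. (q ^ k) ^ d * term_sum u k) + (\<Sum>d<n. E d))"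
    by (simp add: g sum.distrib flip: sum_distrib_left)
  also have "(\<Sum>d<n. \<Sum>k=1..n. (q ^ k) ^ d * term_sum u k)
      = (\<Sum>k=1..n. (\<Sum>d<n. (q ^ k) ^ d) * term_sum u k)"
    by (subst sum.swap) (simp add: sum_distrib_right)
  also have "\<dots> = (\<Sum>k=1..n. term_sum u k / (1 - q ^ k) - (q ^ k) ^ n * (term_sum u k / (1 - q ^ k)))"
  proof (intro sum.cong refl)
    fix k assume "k \<in> {1..n}"
    then have "q ^ k \<noteq> 1" using one_minus_nonzero[OF order_q_power[of k]] by auto
    then have "(\<Sum>d<n. (q ^ k) ^ d) = (1 - (q ^ k) ^ n) / (1 - q ^ k)"
      by (subst sum_gp_strict) auto
    then show "(\<Sum>d<n. (q ^ k) ^ d) * term_sum u k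
        = term_sum u k / (1 - q ^ k) - (q ^ k) ^ n * (term_sum u k / (1 - q ^ k))"
      by (simp only: diff_divide_distrib left_diff_distrib) simp
  qed
  finally have eq: "(\<Sum>d<n. g u (Suc d) - g 0 (Suc d)) - A * (\<Sum>k=1..n. term_sum u k / (1 - q ^ k))
      = A * ((\<Sum>d<n. E d) - (\<Sum>k=1..n. (q ^ k) ^ n * (term_sum u k / (1 - q ^ k))))"
    by (simp add: sum_subtractf algebra_simps)
  have "order_ge (int n) ((q ^ k) ^ n * (term_sum u k / (1 - q ^ k)))" if "k \<in> {1..n}" for k
    using that
    by (intro order_ge_mult_left order_ge_power_1 order_q_power order_ge_divide_one_minus
        order_ge_mono[OF order_term_sum]) auto
  then have "order_ge (int n) (\<Sum>k=1..n. (q ^ k) ^ n * (term_sum u k / (1 - q ^ k)))"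
    by (rule order_ge_sum)
  with order_ge_sum[OF E] show ?thesis
    unfolding eq by (rule order_ge_mult_right[OF order_A order_ge_diff])
qed

text \<open>A tree with \<open>m < n\<close> nodes has height at most \<open>m\<close>, so the
  indices \<open>d \<le> n\<close> account for it completely.\<close>

lemma order_ge_gf_minus_partial_sum:
  "order_ge (int n)
     (fps_to_fls (tree_gf (\<lambda>T. 2 ^ card (markable_edges T) * u ^ card (deepest_nodes T)))
       - (\<Sum>d\<le>n. g u d - g 0 d))"
proof -
  have "fps_nth (tree_gf (\<lambda>T. 2 ^ card (markable_edges T) * u ^ card (deepest_nodes T))) m
      = (\<Sum>d\<le>n. fps_nth (tree_gf (weight u d) - tree_gf (weight 0 d)) m)" if m: "m < n" for m
  proof -
    have "(\<Sum>d\<le>n. fps_nth (tree_gf (weight u d) - tree_gf (weight 0 d)) m)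
        = (\<Sum>d\<le>n. \<Sum>T | card (nodes T) = m. weight u d T - weight 0 d T)"
      by (simp add: tree_gf_def sum_subtractf)
    also have "\<dots> = (\<Sum>T | card (nodes T) = m. \<Sum>d\<le>n. weight u d T - weight 0 d T)"
      by (rule sum.swap)
    also have "\<dots> = (\<Sum>T | card (nodes T) = m. 2 ^ card (markable_edges T) * u ^ card (deepest_nodes T))"
    proof (intro sum.cong refl sum_weight_diff)
      fix T assume "T \<in> {T. card (nodes T) = m}"
      then show "height T \<le> Suc n" using height_le_card_nodes[of T] m by simp
    qed
    finally show ?thesis by (simp add: tree_gf_def)
  qed
  then have "fls_nth (fps_to_fls (tree_gf (\<lambda>T. 2 ^ card (markable_edges T) * u ^ card (deepest_nodes T)))) k
       = fls_nth (\<Sum>d\<le>n. g u d - g 0 d) k" if "k < int n" for k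
    using that by (cases "k < 0") (auto simp: g_def fls_nth_sum nat_less_iff)
  then show ?thesis by (simp add: order_ge_def)
qed

section \<open>The double series of the theorem\<close>

definition F where
  "F u = (\<lambda>(k, i). of_nat (k choose i) * U u ^ i * ((v * (2 * v + 1) / (v + 2)) ^ k * q ^ k / (1 - q ^ k)))"

lemma F_eq: "F u (k, i) = of_nat (k choose i) * U u ^ i * ((v\<^sup>2) ^ k / (1 - q ^ k))"
proof -
  have "v * (2 * v + 1) / (v + 2) * q = v\<^sup>2"
    using two_v_plus_1_nonzero v_plus_2_nonzero by (simp add: q_def power2_eq_square)
  then show ?thesis by (simp add: F_def flip: power_mult_distrib)
qed

lemma sum_F: "(\<Sum>i=1..k. F u (k, i)) = term_sum u k / (1 - q ^ k)"
proof -
  have "(1 + U u) ^ k = (\<Sum>i\<le>k. of_nat (k choose i) * U u ^ i)"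
    using binomial_ring[of "U u" 1 k] by (simp add: add.commute)
  also have "\<dots> = 1 + (\<Sum>i=1..k. of_nat (k choose i) * U u ^ i)"
    by (simp add: sum.atMost_shift sum.atLeast1_atMost_eq lessThan_Suc_atMost)
  finally have "(1 + U u) ^ k - 1 = (\<Sum>i=1..k. of_nat (k choose i) * U u ^ i)" by simp
  then show ?thesis
    unfolding F_eq sum_distrib_right[symmetric] term_sum_def by (simp add: mult.commute)
qed

lemma order_F: "0 < k \<Longrightarrow> order_ge (int k) (F u (k, i))"
  unfolding F_eq
  by (intro order_ge_mult_right order_ge_of_nat order_ge_power_0 order_U
      order_ge_divide_one_minus order_ge_power_1 order_v_sq order_q_power)

text \<open>Cutting off the heights and cutting off \<open>k\<close> at \<open>n\<close> both cause
  errors of order at least \<open>n\<close>, which division by the unit \<open>A\<close>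
  preserves.\<close>

lemma has_sum_F:
  "(F u has_sum
     (fps_to_fls (tree_gf (\<lambda>T. 2 ^ card (markable_edges T) * u ^ card (deepest_nodes T)))
       - fls_X * fls_const u) / A) {(k, i). 1 \<le> i \<and> i \<le> k}"
proof (rule fls_has_sumI)
  let ?G = "fps_to_fls (tree_gf (\<lambda>T. 2 ^ card (markable_edges T) * u ^ card (deepest_nodes T)))"
  \<comment> \<open>Truncating in \<open>k\<close> alone suffices: the order of
    \<open>F u (k, i)\<close> is at least \<open>k\<close> for every \<open>i\<close>.\<close>
  define X :: "nat \<Rightarrow> (nat \<times> nat) set" where "X n = (SIGMA k:{1..n}. {1..k})" for n
  show "finite (X n)" "X n \<subseteq> {(k, i). 1 \<le> i \<and> i \<le> k}" for n
    by (auto simp: X_def)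
  show "order_ge (int n) (F u x)" if "x \<in> {(k, i). 1 \<le> i \<and> i \<le> k}" "x \<notin> X n" for n x
    using that by (cases x) (auto simp: X_def intro: order_ge_mono[OF order_F])
  show "order_ge (int n) ((?G - fls_X * fls_const u) / A - sum (F u) (X n))" for n
  proof -
    let ?S = "\<Sum>k=1..n. term_sum u k / (1 - q ^ k)"
    let ?D = "\<Sum>d<n. g u (Suc d) - g 0 (Suc d)"
    have "sum (F u) (X n) = (\<Sum>k=1..n. \<Sum>i=1..k. F u (k, i))"
      unfolding X_def by (subst sum.Sigma) auto
    also have "\<dots> = ?S" by (simp only: sum_F)
    finally have S: "sum (F u) (X n) = ?S" .
    \<comment> \<open>The summand \<open>d = 0\<close> belongs to the one-node tree and becomes the
      isolated term \<open>z * t\<close>.\<close>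
    have D: "(\<Sum>d\<le>n. g u d - g 0 d) = fls_X * fls_const u + ?D"
      by (simp add: sum.atMost_shift g_0)
    have "(?G - fls_X * fls_const u) / A - sum (F u) (X n)
        = ((?G - (\<Sum>d\<le>n. g u d - g 0 d)) + (?D - A * ?S)) * inverse A"
      unfolding S D using A_nonzero by (simp add: field_simps)
    then show ?thesis
      by (simp only:, intro order_ge_mult_left order_inverse_A order_ge_add
          order_ge_gf_minus_partial_sum sum_g_diff_approx)
  qed
qed

end

subsection \<open>The series \<open>v\<close>\<close>

lemma embed_z_add: "embed_z (f + g) = embed_z f + embed_z g"
  by (rule fls_eqI) (simp add: embed_z_def flip: fls_plus_const)

lemma embed_z_mult: "embed_z (f * g) = embed_z f * embed_z g"
proof -
  have "Abs_fps (\<lambda>n. fls_const (fps_nth (f * g) n))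
      = Abs_fps (\<lambda>n. fls_const (fps_nth f n)) * Abs_fps (\<lambda>n. fls_const (fps_nth g n))"
  proof (rule fps_ext)
    fix n
    have *: "fls_const (sum h B) = (\<Sum>x\<in>B. fls_const (h x))" for h :: "nat \<Rightarrow> real" and B
      by (induction B rule: infinite_finite_induct) (auto simp flip: fls_plus_const)
    show "fps_nth (Abs_fps (\<lambda>n. fls_const (fps_nth (f * g) n))) n
      = fps_nth (Abs_fps (\<lambda>n. fls_const (fps_nth f n)) * Abs_fps (\<lambda>n. fls_const (fps_nth g n))) n"
      by (simp add: fps_mult_nth * flip: fls_const_mult_const)
  qed
  then show ?thesis by (simp add: embed_z_def fls_times_fps_to_fls)
qed

lemma embed_z_1: "embed_z 1 = 1"
  by (rule fls_eqI) (auto simp: embed_z_def)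

lemma embed_z_fps_X: "embed_z fps_X = fls_X"
  by (rule fls_eqI) (auto simp: embed_z_def)

lemma embed_z_v_eq:
  "fls_X * (1 + 3 * embed_z v_fps + embed_z v_fps ^ 2) = embed_z v_fps"
proof -
  \<comment> \<open>The multiple and the square are spelled out so that additivity and
    multiplicativity of \<open>embed_z\<close> apply.\<close>
  have "v_fps = fps_X * (1 + (v_fps + v_fps + v_fps) + v_fps * v_fps)"
    using v_fps_eq by (simp add: power2_eq_square algebra_simps)
  then have "embed_z v_fps = embed_z (fps_X * (1 + (v_fps + v_fps + v_fps) + v_fps * v_fps))"
    by (rule arg_cong)
  also have "\<dots> = fls_X * (1 + (embed_z v_fps + embed_z v_fps + embed_z v_fps)
      + embed_z v_fps * embed_z v_fps)"
    by (simp only: embed_z_add embed_z_mult embed_z_1 embed_z_fps_X)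
  finally show ?thesis by (simp add: power2_eq_square)
qed

lemma order_embed_z_v: "order_ge 1 (embed_z v_fps)"
proof -
  have "fls_nth (embed_z v_fps) k = 0" if "k < 1" for k
    using that v_fps_nth_0 by (cases "k = 0") (auto simp: embed_z_def)
  then show ?thesis by (simp add: order_ge_def)
qed

theorem theorem1:
  fixes z t v q \<delta> :: "real fls fls"
    and F :: "nat \<times> nat \<Rightarrow> real fls fls"
    and I :: "(nat \<times> nat) set"
  assumes "z = ser_z" and "t = ser_t" and "v = embed_z v_fps"
    and "q = v * (v + 2) / (2 * v + 1)"
    and "\<delta> = v * (2 * v + 1) / (v + 2)"
    and "F = (\<lambda>(k, i). of_nat (k choose i)
               * ((v - 1) / v * (t * (1 + v) * z / (1 - t * (1 + v) * z))) ^ i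
               * (\<delta> ^ k * q ^ k / (1 - q ^ k)))"
    and "I = {(k, i). 1 \<le> i \<and> i \<le> k}"
  shows "F summable_on I \<and> ser_G = z * t + z * (v\<^sup>2 - 1) / v * infsum F I"
proof -
  \<comment> \<open>The coefficients are now Laurent series in \<open>t\<close>, so \<open>u\<close>
    can be taken to be \<open>t\<close>, the inner \<open>fls_X\<close>.\<close>
  interpret S: marked_tree_series v
    using embed_z_v_eq order_embed_z_v unfolding assms(3) by unfold_locales
  have q: "q = S.q" by (simp add: S.q_def assms(4))
  have F: "F = S.F fls_X"
    unfolding assms(6) S.F_def S.U_def S.y_def assms(5) q by (simp add: assms(1,2) ser_t_def ser_z_def)
  have A: "z * (v\<^sup>2 - 1) / v = S.A" by (simp add: S.A_def assms(1) ser_z_def)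
  have zt: "z * t = fls_X * fls_const fls_X" by (simp add: assms(1,2) ser_z_def ser_t_def)
  have sum: "(F has_sum (ser_G - z * t) / S.A) I"
    unfolding F assms(7) zt ser_G_eq_tree_gf by (rule S.has_sum_F)
  moreover have "ser_G = z * t + S.A * ((ser_G - z * t) / S.A)"
    using S.A_nonzero by simp
  ultimately show ?thesis
    unfolding A by (metis has_sum_imp_summable infsumI)
qed

end
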